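(* Let $G$ be a finite simple graph of order $n\geq 2$ and size $m\geq 1$, and let $S\subseteq V(G)$, where $|S|=\sigma$, $0\leq\sigma\leq n$. Then $$\mathcal{L}_{n,\sigma}\leq \mathcal{E}(G_S)+\mathcal{E}(\overline{G_S})\leq \mathcal{U}_{n,\sigma},$$ where $$\mathcal{L}_{n,\sigma} = (\sigma-1)\left|1-\frac{2\sigma}{n}\right|+(n-\sigma-1)\left(1+\frac{2\sigma}{n}\right)+ \frac{1}{2}\left|n-\frac{4\sigma}{n}+\sqrt{(n-2)^2+8\sigma}\right| + \frac{1}{2}\left|n-\frac{4\sigma}{n}-\sqrt{(n-2)^2+8\sigma}\right|,$$ and $$\mathcal{U}_{n,\sigma}=2\sqrt{2}\,\sqrt{2\sigma(n-1)(n-\sigma)+(n^2-n)^2}.$$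
   Context: The size $m$ is the number of edges of $G$ (loops are not counted). The self-loop graph $G_S$ is obtained from $G$ by attaching one loop at each vertex of $S$; its adjacency matrix is $A(G_S)=A(G)+\mathfrak{I}_S$, where $\mathfrak{I}_S$ is the diagonal $0/1$ matrix with ones exactly at the positions corresponding to $S$. The complement of $G_S$ is defined as $\overline{G_S}:=\overline{G}_S$, i.e. the graph obtained from the usual complement $\overline{G}$ by attaching loops at the vertices of the same set $S$. For a self-loop graph $H$ of order $n$ with $\sigma$ loops and adjacency eigenvalues $\lambda_1(H)\ge\cdots\ge\lambda_n(H)$, the energy is $\mathcal{E}(H)=\sum_{i=1}^n\left|\lambda_i(H)-\frac{\sigma}{n}\right|$. *)

theory Defs
  imports
    Complex_Main
    "HOL-Library.Countable_Set"
    "HOL-Library.Multiset"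
    "HOL-Computational_Algebra.Polynomial"
    "Jordan_Normal_Form.Char_Poly"
begin

text \<open>
  A graph is a vertex set \<open>V\<close> with a set \<open>E\<close> of two-element subsets of \<open>V\<close>;
  the self-loop graph \<open>G\<^sub>S\<close> is given by the triple \<open>V\<close>, \<open>E\<close>, \<open>S\<close>. Loops are never members
  of \<open>E\<close>, so the size of the graph is \<open>card E\<close>.
\<close>

definition simple_graph :: "'a set \<Rightarrow> 'a set set \<Rightarrow> bool" where
  "simple_graph V E \<longleftrightarrow> finite V \<and> E \<subseteq> {e. e \<subseteq> V \<and> card e = 2}"

definition complement_edges :: "'a set \<Rightarrow> 'a set set \<Rightarrow> 'a set set" where
  "complement_edges V E = {e. e \<subseteq> V \<and> card e = 2} - E"

text \<open>
  Rows and columns are indexed by \<open>0, \<dots>, card V - 1\<close> through the library bijection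
  \<open>from_nat_into V\<close> from \<open>{..<card V}\<close> onto the finite set \<open>V\<close>. Another enumeration of \<open>V\<close>
  conjugates the matrices below by one common permutation matrix, which leaves the
  spectrum unchanged.
\<close>

definition adjacency_matrix :: "'a set \<Rightarrow> 'a set set \<Rightarrow> real mat" where
  "adjacency_matrix V E =
     mat (card V) (card V)
       (\<lambda>(i, j). if {from_nat_into V i, from_nat_into V j} \<in> E then 1 else 0)"

definition loop_matrix :: "'a set \<Rightarrow> 'a set \<Rightarrow> real mat" where
  "loop_matrix V S =
     mat (card V) (card V)
       (\<lambda>(i, j). if i = j \<and> from_nat_into V i \<in> S then 1 else 0)"

definition self_loop_adjacency_matrix :: "'a set \<Rightarrow> 'a set set \<Rightarrow> 'a set \<Rightarrow> real mat" where
  "self_loop_adjacency_matrix V E S = adjacency_matrix V E + loop_matrix V S"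

text \<open>
  The \<open>i\<close>-th largest eigenvalue, \<open>i = 1, \<dots>, card V\<close>, counted with algebraic multiplicity.
  The matrix is real symmetric, so its characteristic polynomial splits over the reals and
  the list of its real roots has length \<open>card V\<close>.
\<close>

definition graph_eigenvalue :: "'a set \<Rightarrow> 'a set set \<Rightarrow> 'a set \<Rightarrow> nat \<Rightarrow> real" where
  "graph_eigenvalue V E S i =
     rev (sorted_list_of_multiset (proots (char_poly (self_loop_adjacency_matrix V E S)))) ! (i - 1)"

definition energy :: "'a set \<Rightarrow> 'a set set \<Rightarrow> 'a set \<Rightarrow> real" where
  "energy V E S =
     (\<Sum>i = 1..card V. \<bar>graph_eigenvalue V E S i - real (card S) / real (card V)\<bar>)"

definition energy_lower :: "nat \<Rightarrow> nat \<Rightarrow> real" where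
  "energy_lower n \<sigma> =
     (real \<sigma> - 1) * \<bar>1 - 2 * real \<sigma> / real n\<bar>
     + (real n - real \<sigma> - 1) * (1 + 2 * real \<sigma> / real n)
     + 1 / 2 * \<bar>real n - 4 * real \<sigma> / real n + sqrt ((real n - 2)\<^sup>2 + 8 * real \<sigma>)\<bar>
     + 1 / 2 * \<bar>real n - 4 * real \<sigma> / real n - sqrt ((real n - 2)\<^sup>2 + 8 * real \<sigma>)\<bar>"

definition energy_upper :: "nat \<Rightarrow> nat \<Rightarrow> real" where
  "energy_upper n \<sigma> =
     2 * sqrt 2 *
     sqrt (2 * real \<sigma> * (real n - 1) * (real n - real \<sigma>) + ((real n)\<^sup>2 - real n)\<^sup>2)"

end

theory Submission
  imports Defs "HOL-Analysis.Convex"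
begin

text \<open>
  Let \<open>M\<close> and \<open>M'\<close> be the adjacency matrices of \<open>G\<^sub>S\<close> and its complement, both shifted by
  \<open>- \<sigma>/n\<close>. The two energies are the trace norms of \<open>M\<close> and \<open>M'\<close>, and \<open>M + M'\<close> does not
  depend on the edges: it is \<open>1\<close> off the diagonal and \<open>2d\<^sub>i - 2\<sigma>/n\<close> on it, with \<open>d\<close> the
  indicator of \<open>S\<close>.

  Upper bound: by Cauchy--Schwarz a squared trace norm is at most \<open>n\<close> times the squared
  Frobenius norm, and \<open>M\<^sub>i\<^sub>j\<^sup>2 + M'\<^sub>i\<^sub>j\<^sup>2 = 1\<close> off the diagonal.

  Lower bound: the trace norm of \<open>M\<close> dominates the trace of \<open>M U\<close> whenever the quadratic form
  of \<open>U\<close> is bounded by that of the identity. Testing \<open>M\<close> and \<open>M'\<close> against the same \<open>U\<close>, the sign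
  matrix of \<open>M + M'\<close>, gives the trace norm of \<open>M + M'\<close>, which is the stated bound. On vectors
  summing to zero over \<open>S\<close> and over its complement \<open>M + M'\<close> is the scalar \<open>1 - 2\<sigma>/n\<close>
  resp. \<open>- 1 - 2\<sigma>/n\<close>; on the span of the two indicator vectors it is a symmetric
  \<open>2 \<times> 2\<close> matrix, whose trace norm is the larger of the moduli of the sum and of the
  difference of its eigenvalues, so that \<open>\<plusminus>1\<close> and a reflection suffice as test matrices.
\<close>

section \<open>The spectral theorem for real symmetric matrices\<close>

lemma real_symmetric_complex_eigenvalue_real:
  fixes A :: "real mat" and k :: complex
  assumes A: "A \<in> carrier_mat n n" and sym: "A\<^sup>T = A"
    and ev: "eigenvalue (map_mat complex_of_real A) k"
  shows "k \<in> \<real>"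
proof -
  let ?A = "map_mat complex_of_real A"
  obtain v where v: "v \<in> carrier_vec n" "v \<noteq> 0\<^sub>v n" and eq: "?A *\<^sub>v v = k \<cdot>\<^sub>v v"
    using ev A unfolding eigenvalue_def eigenvector_def by auto
  have row: "(\<Sum>j<n. complex_of_real (A $$ (i,j)) * v $ j) = k * v $ i" if "i < n" for i
  proof -
    have "(?A *\<^sub>v v) $ i = k * v $ i" using eq v(1) that by simp
    thus ?thesis using that A v(1) by (simp add: scalar_prod_def atLeast0LessThan)
  qed
  \<comment> \<open>\<open>q\<close> is the Hermitian form of \<open>A\<close> at \<open>v\<close>.
    It is real by symmetry, and the eigenvalue equation makes it \<open>k\<close> times the squared
    norm of \<open>v\<close>.\<close>
  define q where "q = (\<Sum>i<n. \<Sum>j<n. cnj (v $ i) * complex_of_real (A $$ (i,j)) * v $ j)"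
  have symA: "A $$ (i,j) = A $$ (j,i)" if "i < n" "j < n" for i j
    using arg_cong[OF sym, of "\<lambda>B. B $$ (i,j)"] that A by simp
  have "cnj q = (\<Sum>i<n. \<Sum>j<n. v $ i * complex_of_real (A $$ (i,j)) * cnj (v $ j))"
    by (simp add: q_def)
  also have "\<dots> = (\<Sum>j<n. \<Sum>i<n. v $ i * complex_of_real (A $$ (i,j)) * cnj (v $ j))"
    by (rule sum.swap)
  also have "\<dots> = q"
    unfolding q_def by (intro sum.cong refl) (simp add: symA mult.commute mult.left_commute)
  finally have q_real: "cnj q = q" .
  define N where "N = (\<Sum>i<n. (cmod (v $ i))\<^sup>2)"
  have "q = (\<Sum>i<n. cnj (v $ i) * (\<Sum>j<n. complex_of_real (A $$ (i,j)) * v $ j))"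
    by (simp add: q_def sum_distrib_left mult.assoc)
  also have "\<dots> = (\<Sum>i<n. cnj (v $ i) * (k * v $ i))"
    by (intro sum.cong refl) (simp add: row)
  also have "\<dots> = k * of_real N"
    by (simp add: N_def sum_distrib_left complex_norm_square mult.commute mult.left_commute
        flip: of_real_power)
  finally have q: "q = k * of_real N" .
  obtain i where i: "i < n" "v $ i \<noteq> 0" using v by (metis eq_vecI carrier_vecD index_zero_vec)
  have "0 < (cmod (v $ i))\<^sup>2" using i by simp
  also have "\<dots> \<le> N" unfolding N_def by (rule member_le_sum) (use i in auto)
  finally have "N \<noteq> 0" by simp
  with q q_real have "cnj k = k" by simp
  thus ?thesis by (simp add: Reals_cnj_iff)
qed

text \<open>The fundamental theorem of algebra supplies a complex root of the characteristic
  polynomial. By the previous lemma it is real, hence an eigenvalue of \<open>A\<close> over the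
  reals.\<close>

lemma real_symmetric_eigenvector_exists:
  fixes A :: "real mat"
  assumes A: "A \<in> carrier_mat n n" and sym: "A\<^sup>T = A" and n: "n > 0"
  obtains v e where "v \<in> carrier_vec n" "scalar_prod v v = 1" "A *\<^sub>v v = e \<cdot>\<^sub>v v"
proof -
  let ?A = "map_mat complex_of_real A"
  have A': "?A \<in> carrier_mat n n" using A by simp
  have "degree (char_poly ?A) > 0" using degree_monic_char_poly[OF A'] n by simp
  hence "\<not> constant (poly (char_poly ?A))" by (simp add: constant_degree)
  then obtain k where k: "poly (char_poly ?A) k = 0"
    using fundamental_theorem_of_algebra by blast
  hence "eigenvalue ?A k" using eigenvalue_root_char_poly[OF A'] by simp
  from real_symmetric_complex_eigenvalue_real[OF A sym this]
  obtain e where e: "k = of_real e" by (auto elim: Reals_cases)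
  have "poly (char_poly A) e = 0"
    using k unfolding e of_real_hom.char_poly_hom[OF A] by simp
  hence "eigenvalue A e" using eigenvalue_root_char_poly[OF A] by simp
  then obtain u where u: "u \<in> carrier_vec n" "u \<noteq> 0\<^sub>v n" "A *\<^sub>v u = e \<cdot>\<^sub>v u"
    using A unfolding eigenvalue_def eigenvector_def by auto
  have "scalar_prod u u > 0" using conjugate_square_greater_0_vec[OF u(1)] u(2) by simp
  define v where "v = (1 / sqrt (scalar_prod u u)) \<cdot>\<^sub>v u"
  show thesis
  proof
    show "v \<in> carrier_vec n" using u by (simp add: v_def)
    show "scalar_prod v v = 1" using u \<open>scalar_prod u u > 0\<close> by (simp add: v_def)
    show "A *\<^sub>v v = e \<cdot>\<^sub>v v"
      using u A by (simp add: v_def smult_smult_assoc mult.commute mult_mat_vec)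
  qed
qed

text \<open>\<open>H\<close> is the Householder reflection \<open>I - 2 w w^T / |w|^2\<close> with
  \<open>w = e_0 - v\<close>, which interchanges the unit vectors \<open>e_0\<close> and
  \<open>v\<close>. It later moves an eigenvector into the first coordinate.\<close>

lemma householder_exists:
  fixes v :: "real vec"
  assumes v: "v \<in> carrier_vec (Suc n)" and unit: "scalar_prod v v = 1"
  obtains H where "H \<in> carrier_mat (Suc n) (Suc n)" "H\<^sup>T = H" "H * H = 1\<^sub>m (Suc n)"
    "H *\<^sub>v unit_vec (Suc n) 0 = v"
proof -
  let ?n = "Suc n"
  define w where "w i = (if i = 0 then 1 else 0) - v $ i" for i
  define q where "q = (\<Sum>i<?n. (w i)\<^sup>2)"
  \<comment> \<open>If \<open>v\<close> is the first unit vector then \<open>q = 0\<close>, hence \<open>t = 0\<close> and \<open>H\<close> is the identity.\<close>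
  define t where "t = 2 / q"
  define H where "H = mat ?n ?n (\<lambda>(i,j). (if i = j then 1 else 0) - t * w i * w j)"
  have tq: "t * t * q = 2 * t" by (simp add: t_def)
  have vv: "(\<Sum>i<?n. (v $ i)\<^sup>2) = 1"
    using unit v by (simp add: scalar_prod_def power2_eq_square atLeast0LessThan)
  have "q = (\<Sum>i<?n. (if i = 0 then 1 - 2 * v $ 0 else 0) + (v $ i)\<^sup>2)"
    unfolding q_def w_def by (intro sum.cong refl) (simp add: power2_eq_square algebra_simps)
  also have "\<dots> = 2 * w 0"
    by (simp only: sum.distrib vv sum.delta[OF finite_lessThan]) (simp add: w_def)
  finally have q: "q = 2 * w 0" .
  \<comment> \<open>Since \<open>v\<close> is a unit vector, \<open>q = 2 * w 0\<close>, so
    \<open>t * w 0 = 1\<close> unless \<open>w\<close> vanishes. Hence the first column of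
    \<open>H\<close> is \<open>e_0 - w = v\<close>.\<close>
  have tw: "t * w 0 * w i = w i" if "i < ?n" for i
  proof (cases "q = 0")
    case True
    hence "(w i)\<^sup>2 = 0" using that unfolding q_def
      by (subst (asm) sum_nonneg_eq_0_iff) auto
    thus ?thesis by simp
  next
    case False
    thus ?thesis by (simp add: t_def q)
  qed
  have H: "H \<in> carrier_mat ?n ?n" by (simp add: H_def)
  show thesis
  proof
    show "H \<in> carrier_mat ?n ?n" by (rule H)
    show "H\<^sup>T = H" by (rule eq_matI) (auto simp: H_def)
    show "H * H = 1\<^sub>m ?n"
    proof (rule eq_matI)
      fix i j assume "i < dim_row (1\<^sub>m ?n)" "j < dim_col (1\<^sub>m ?n)"
      hence ij: "i < ?n" "j < ?n" by auto
      have "(H * H) $$ (i,j) = (\<Sum>k<?n. ((if i = k then 1 else 0) - t * w i * w k) *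
          ((if k = j then 1 else 0) - t * w k * w j))"
        using ij H by (simp add: scalar_prod_def H_def atLeast0LessThan del: sum.lessThan_Suc)
      also have "\<dots> = (\<Sum>k<?n. (if k = i then (if i = j then 1 else 0) - t * w i * w j else 0)
          - (if k = j then t * w i * w j else 0) + t * t * w i * w j * (w k)\<^sup>2)"
        by (intro sum.cong refl) (auto simp: algebra_simps power2_eq_square)
      also have "\<dots> = (if i = j then 1 else 0) - 2 * t * w i * w j + (t * t * q) * w i * w j"
        using ij unfolding q_def
        by (simp add: sum.distrib sum_subtractf sum_distrib_left sum_distrib_right
            mult_ac del: sum.lessThan_Suc)
      also have "\<dots> = 1\<^sub>m ?n $$ (i,j)" using ij by (simp add: tq)
      finally show "(H * H) $$ (i,j) = 1\<^sub>m ?n $$ (i,j)" .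
    qed (use H in auto)
    show "H *\<^sub>v unit_vec ?n 0 = v"
    proof (rule eq_vecI)
      fix i assume "i < dim_vec v"
      hence i: "i < ?n" using v by simp
      have "(H *\<^sub>v unit_vec ?n 0) $ i = H $$ (i,0)"
        using i H by (simp add: row_def)
      also have "\<dots> = (if i = 0 then 1 else 0) - w i"
        using i tw[OF i] by (simp add: H_def mult_ac del: mult_cancel_right1 mult_cancel_right2)
      also have "\<dots> = v $ i" by (simp add: w_def)
      finally show "(H *\<^sub>v unit_vec ?n 0) $ i = v $ i" .
    qed (use H v in auto)
  qed
qed

text \<open>Deflation: conjugating by a reflection that sends \<open>e_0\<close> to a unit
  eigenvector clears the first column below the diagonal, and by symmetry the first row. The
  remaining block \<open>C\<close> is symmetric of order \<open>n\<close> and falls under the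
  induction hypothesis.\<close>

theorem real_symmetric_spectral:
  fixes A :: "real mat"
  assumes "A \<in> carrier_mat n n" and "A\<^sup>T = A"
  shows "\<exists>P D. P \<in> carrier_mat n n \<and> D \<in> carrier_mat n n \<and> P\<^sup>T * P = 1\<^sub>m n \<and>
    diagonal_mat D \<and> A = P * D * P\<^sup>T"
  using assms
proof (induction n arbitrary: A)
  case 0
  show ?case
    by (rule exI[of _ "1\<^sub>m 0"], rule exI[of _ "1\<^sub>m 0"])
      (use 0 in \<open>auto simp: diagonal_mat_def intro!: eq_matI\<close>)
next
  case (Suc n)
  let ?n = "Suc n"
  note A = Suc.prems(1)
  obtain v e where v: "v \<in> carrier_vec ?n" "scalar_prod v v = 1" and Av: "A *\<^sub>v v = e \<cdot>\<^sub>v v"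
    using real_symmetric_eigenvector_exists[OF Suc.prems] by blast
  obtain H where H: "H \<in> carrier_mat ?n ?n" and HT: "H\<^sup>T = H" and HH: "H * H = 1\<^sub>m ?n"
    and He: "H *\<^sub>v unit_vec ?n 0 = v"
    using householder_exists[OF v] by blast
  define B where "B = H * A * H"
  have B: "B \<in> carrier_mat ?n ?n" using A H by (simp add: B_def)
  have BT: "B\<^sup>T = B"
    unfolding B_def using A H HT Suc.prems(2)
    by (simp add: transpose_mult[of _ ?n ?n _ ?n] assoc_mult_mat[of _ ?n ?n _ ?n _ ?n])
  have Hv: "H *\<^sub>v v = unit_vec ?n 0"
  proof -
    have "H *\<^sub>v v = (H * H) *\<^sub>v unit_vec ?n 0"
      unfolding He[symmetric] using H by (simp add: assoc_mult_mat_vec[of _ ?n ?n _ ?n])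
    thus ?thesis by (simp add: HH)
  qed
  have "B *\<^sub>v unit_vec ?n 0 = H *\<^sub>v (A *\<^sub>v (H *\<^sub>v unit_vec ?n 0))"
    unfolding B_def using A H by (simp add: assoc_mult_mat_vec[of _ ?n ?n _ ?n])
  also have "\<dots> = e \<cdot>\<^sub>v unit_vec ?n 0"
    using v H by (simp add: He Av Hv mult_mat_vec[of _ ?n ?n])
  finally have Be: "B *\<^sub>v unit_vec ?n 0 = e \<cdot>\<^sub>v unit_vec ?n 0" .
  have col0: "B $$ (i, 0) = (if i = 0 then e else 0)" if "i < ?n" for i
    using arg_cong[OF Be, of "\<lambda>u. u $ i"] that B by (simp add: row_def split: if_splits)
  have symB: "B $$ (i, j) = B $$ (j, i)" if "i < ?n" "j < ?n" for i j
    using arg_cong[OF BT, of "\<lambda>B. B $$ (i, j)"] that B by simp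
  define C where "C = mat n n (\<lambda>(i, j). B $$ (Suc i, Suc j))"
  have C: "C \<in> carrier_mat n n" by (simp add: C_def)
  have CT: "C\<^sup>T = C" by (rule eq_matI) (auto simp: C_def symB)
  let ?e = "mat 1 1 (\<lambda>_. e)"
  have B_block: "B = four_block_mat ?e (0\<^sub>m 1 n) (0\<^sub>m n 1) C"
  proof (rule eq_matI)
    fix i j assume "i < dim_row (four_block_mat ?e (0\<^sub>m 1 n) (0\<^sub>m n 1) C)"
      "j < dim_col (four_block_mat ?e (0\<^sub>m 1 n) (0\<^sub>m n 1) C)"
    hence "i < ?n" "j < ?n" by (auto simp: C_def)
    thus "B $$ (i, j) = four_block_mat ?e (0\<^sub>m 1 n) (0\<^sub>m n 1) C $$ (i, j)"
      using col0[of i] col0[of j] symB[of i j] by (cases i; cases j) (auto simp: C_def)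
  qed (use B C in auto)
  obtain Q D where Q: "Q \<in> carrier_mat n n" and D: "D \<in> carrier_mat n n"
    and QQ: "Q\<^sup>T * Q = 1\<^sub>m n" and diag: "diagonal_mat D" and CQ: "C = Q * D * Q\<^sup>T"
    using Suc.IH[OF C CT] by blast
  define F where "F = four_block_mat (1\<^sub>m 1) (0\<^sub>m 1 n) (0\<^sub>m n 1) Q"
  define D' where "D' = four_block_mat ?e (0\<^sub>m 1 n) (0\<^sub>m n 1) D"
  have F: "F \<in> carrier_mat ?n ?n" and D': "D' \<in> carrier_mat ?n ?n"
    using Q D by (auto simp: F_def D'_def)
  have FT: "F\<^sup>T = four_block_mat (1\<^sub>m 1) (0\<^sub>m 1 n) (0\<^sub>m n 1) Q\<^sup>T"
    unfolding F_def using Q by (subst transpose_four_block_mat) auto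
  have FF: "F\<^sup>T * F = 1\<^sub>m ?n"
    unfolding FT unfolding F_def using Q
    by (subst mult_four_block_mat[of _ 1 1 _ n _ n _ _ 1 _ n]) (auto simp: QQ)
  have "F * D' = four_block_mat ?e (0\<^sub>m 1 n) (0\<^sub>m n 1) (Q * D)"
    unfolding F_def D'_def using Q D
    by (subst mult_four_block_mat[of _ 1 1 _ n _ n _ _ 1 _ n]) auto
  hence BF: "F * D' * F\<^sup>T = B"
    unfolding FT B_block CQ using Q D
    by simp (subst mult_four_block_mat[of _ 1 1 _ n _ n _ _ 1 _ n], auto)
  have diag': "diagonal_mat D'"
    using diag D unfolding diagonal_mat_def D'_def by auto
  show ?case
  proof (intro exI conjI)
    show "H * F \<in> carrier_mat ?n ?n" "D' \<in> carrier_mat ?n ?n" using H F D' by auto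
    show "diagonal_mat D'" by (rule diag')
    have "(H * F)\<^sup>T * (H * F) = F\<^sup>T * (H * H) * F"
      using H F by (simp add: transpose_mult[of _ ?n ?n _ ?n] HT assoc_mult_mat[of _ ?n ?n _ ?n _ ?n])
    thus "(H * F)\<^sup>T * (H * F) = 1\<^sub>m ?n" using F by (simp add: HH FF)
    have "A = (H * H) * A * (H * H)" using A by (simp add: HH)
    also have "\<dots> = H * B * H"
      unfolding B_def using A H by (simp add: assoc_mult_mat[of _ ?n ?n _ ?n _ ?n])
    also have "\<dots> = (H * F) * D' * (H * F)\<^sup>T"
      unfolding BF[symmetric] using H F D'
      by (simp add: transpose_mult[of _ ?n ?n _ ?n] HT assoc_mult_mat[of _ ?n ?n _ ?n _ ?n])
    finally show "A = (H * F) * D' * (H * F)\<^sup>T" .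
  qed
qed

text \<open>The spectral theorem in coordinates, \<open>p k\<close> being the \<open>k\<close>-th
  column of \<open>P\<close>. Orthonormality of the rows expresses the identity matrix in the same
  basis, so that subtracting a scalar matrix merely shifts the \<open>l k\<close>. Similarity to
  \<open>D\<close> identifies the \<open>l k\<close> with the roots, multiplicities
  included.\<close>

lemma real_symmetric_eigenbasis:
  fixes A :: "real mat"
  assumes A: "A \<in> carrier_mat n n" and sym: "A\<^sup>T = A"
  shows "\<exists>(p :: nat \<Rightarrow> nat \<Rightarrow> real) l.
    (\<forall>k<n. \<forall>k'<n. (\<Sum>i<n. p k i * p k' i) = (if k = k' then 1 else 0)) \<and>
    (\<forall>i<n. \<forall>j<n. (\<Sum>k<n. p k i * p k j) = (if i = j then 1 else 0)) \<and>
    (\<forall>i<n. \<forall>j<n. A $$ (i, j) = (\<Sum>k<n. l k * p k i * p k j)) \<and>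
    proots (char_poly A) = image_mset l (mset_set {..<n})"
proof -
  obtain P D where P: "P \<in> carrier_mat n n" and D: "D \<in> carrier_mat n n"
    and PP: "P\<^sup>T * P = 1\<^sub>m n" and diag: "diagonal_mat D" and APD: "A = P * D * P\<^sup>T"
    using real_symmetric_spectral[OF assms] by blast
  have PP': "P * P\<^sup>T = 1\<^sub>m n" using mat_mult_left_right_inverse[OF _ P PP] P by simp
  define p where "p k i = P $$ (i, k)" for k i
  define l where "l k = D $$ (k, k)" for k
  have cols: "(\<Sum>i<n. p k i * p k' i) = (if k = k' then 1 else 0)" if "k < n" "k' < n" for k k'
    using arg_cong[OF PP, of "\<lambda>B. B $$ (k, k')"] that P
    by (simp add: p_def scalar_prod_def atLeast0LessThan)
  have rows: "(\<Sum>k<n. p k i * p k j) = (if i = j then 1 else 0)" if "i < n" "j < n" for i j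
    using arg_cong[OF PP', of "\<lambda>B. B $$ (i, j)"] that P
    by (simp add: p_def scalar_prod_def atLeast0LessThan)
  have PD: "(P * D) $$ (i, k) = l k * p k i" if "i < n" "k < n" for i k
  proof -
    have "(P * D) $$ (i, k) = (\<Sum>j<n. P $$ (i, j) * D $$ (j, k))"
      using that P D by (simp add: scalar_prod_def atLeast0LessThan)
    also have "\<dots> = (\<Sum>j<n. if j = k then l k * p k i else 0)"
      using that D diag by (intro sum.cong refl) (auto simp: diagonal_mat_def l_def p_def)
    finally show ?thesis using that by simp
  qed
  have entries: "A $$ (i, j) = (\<Sum>k<n. l k * p k i * p k j)" if "i < n" "j < n" for i j
  proof -
    have "P * D \<in> carrier_mat n n" using P D by simp
    hence "A $$ (i, j) = (\<Sum>k<n. (P * D) $$ (i, k) * P $$ (j, k))"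
      unfolding APD using that P
      by (subst index_mult_mat) (auto simp: scalar_prod_def atLeast0LessThan simp del: index_mult_mat(1))
    thus ?thesis using that PD by (simp add: p_def)
  qed
  have "similar_mat A D"
    unfolding similar_mat_def
    by (intro exI[of _ P] exI[of _ "P\<^sup>T"] similar_mat_witI[OF PP' PP APD]) (use A P D in auto)
  hence "char_poly A = char_poly D" by (rule char_poly_similar)
  also have "\<dots> = (\<Prod>a\<leftarrow>diag_mat D. [:- a, 1:])"
    by (rule char_poly_upper_triangular[OF D]) (use diag D in \<open>auto simp: diagonal_mat_def\<close>)
  also have "diag_mat D = map l [0..<n]" using D by (simp add: diag_mat_def l_def[abs_def])
  finally have "char_poly A = (\<Prod>k\<in>{..<n}. [:- l k, 1:])"
    using prod.distinct_set_conv_list[of "[0..<n]" "\<lambda>k. [:- l k, 1:]"]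
    by (simp add: o_def atLeast0LessThan)
  hence "proots (char_poly A) = (\<Sum>k<n. {#l k#})" by (simp add: proots_prod)
  also have "\<dots> = image_mset l (mset_set {..<n})" by (simp add: sum_unfold_sum_mset)
  finally have roots: "proots (char_poly A) = image_mset l (mset_set {..<n})" .
  show ?thesis
    by (rule exI[of _ p], rule exI[of _ l]) (use cols rows entries roots in simp)
qed

section \<open>The energy as a trace norm, and two estimates for it\<close>

lemma sum_nth_rev_sorted_list_of_multiset:
  fixes f :: "'a::linorder \<Rightarrow> 'b::comm_monoid_add"
  shows "(\<Sum>i = 1..size M. f (rev (sorted_list_of_multiset M) ! (i - 1))) = (\<Sum>x\<in>#M. f x)"
proof -
  let ?xs = "rev (sorted_list_of_multiset M)"
  have len: "length ?xs = size M" by (metis mset_rev mset_sorted_list_of_multiset size_mset)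
  have "(\<Sum>i = 1..size M. f (?xs ! (i - 1))) = (\<Sum>i<length ?xs. f (?xs ! i))"
    unfolding len by (rule sum.reindex_bij_witness[of _ Suc "\<lambda>i. i - 1"]) auto
  also have "\<dots> = sum_list (map f ?xs)"
    by (simp add: sum_list_sum_nth atLeast0LessThan)
  also have "\<dots> = (\<Sum>x\<in>#mset ?xs. f x)" by (metis mset_map sum_mset_sum_list)
  finally show ?thesis by simp
qed

lemma self_loop_adjacency_matrix_carrier:
  "self_loop_adjacency_matrix V E S \<in> carrier_mat (card V) (card V)"
  by (simp add: self_loop_adjacency_matrix_def adjacency_matrix_def loop_matrix_def)

lemma self_loop_adjacency_matrix_symmetric:
  "(self_loop_adjacency_matrix V E S)\<^sup>T = self_loop_adjacency_matrix V E S"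
  by (rule eq_matI)
    (auto simp: self_loop_adjacency_matrix_def adjacency_matrix_def loop_matrix_def insert_commute)

text \<open>An entry function rather than a matrix, since the estimates below work with double sums
  over entries.\<close>

definition loop_shifted_entry :: "'a set \<Rightarrow> 'a set set \<Rightarrow> 'a set \<Rightarrow> nat \<Rightarrow> nat \<Rightarrow> real" where
  "loop_shifted_entry V E S i j = self_loop_adjacency_matrix V E S $$ (i, j)
     - (if i = j then real (card S) / real (card V) else 0)"

lemma energy_spectral:
  "\<exists>(p :: nat \<Rightarrow> nat \<Rightarrow> real) \<mu>.
    (\<forall>k<card V. \<forall>k'<card V. (\<Sum>i<card V. p k i * p k' i) = (if k = k' then 1 else 0)) \<and>
    (\<forall>i<card V. \<forall>j<card V.
      loop_shifted_entry V E S i j = (\<Sum>k<card V. \<mu> k * p k i * p k j)) \<and>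
    energy V E S = (\<Sum>k<card V. \<bar>\<mu> k\<bar>)"
proof -
  let ?n = "card V" and ?c = "real (card S) / real (card V)"
  let ?A = "self_loop_adjacency_matrix V E S"
  obtain p l
    where cols: "\<forall>k<?n. \<forall>k'<?n. (\<Sum>i<?n. p k i * p k' i) = (if k = k' then 1 else 0)"
      and rows: "\<forall>i<?n. \<forall>j<?n. (\<Sum>k<?n. p k i * p k j) = (if i = j then 1 else 0)"
      and entries: "\<forall>i<?n. \<forall>j<?n. ?A $$ (i, j) = (\<Sum>k<?n. l k * p k i * p k j)"
      and roots: "proots (char_poly ?A) = image_mset l (mset_set {..<?n})"
    using real_symmetric_eigenbasis[OF self_loop_adjacency_matrix_carrier
        self_loop_adjacency_matrix_symmetric, of V E S] by blast
  have shifted: "loop_shifted_entry V E S i j = (\<Sum>k<?n. (l k - ?c) * p k i * p k j)"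
    if "i < ?n" "j < ?n" for i j
  proof -
    have "(\<Sum>k<?n. (l k - ?c) * p k i * p k j) =
        (\<Sum>k<?n. l k * p k i * p k j) - ?c * (\<Sum>k<?n. p k i * p k j)"
      by (simp add: left_diff_distrib sum_subtractf sum_distrib_left mult.assoc)
    thus ?thesis using that by (simp add: loop_shifted_entry_def entries rows)
  qed
  have energy: "energy V E S = (\<Sum>k<?n. \<bar>l k - ?c\<bar>)"
  proof -
    \<comment> \<open>\<open>energy\<close> reads the sorted list of roots at \<open>card V\<close>
      positions, so the multiset of roots must have exactly this size.\<close>
    have size: "size (image_mset l (mset_set {..<?n})) = ?n" by simp
    have "energy V E S = (\<Sum>x\<in>#image_mset l (mset_set {..<?n}). \<bar>x - ?c\<bar>)"
      using sum_nth_rev_sorted_list_of_multiset[of "\<lambda>x. \<bar>x - ?c\<bar>" "image_mset l (mset_set {..<?n})"]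
      unfolding energy_def graph_eigenvalue_def roots size .
    thus ?thesis by (simp add: sum_unfold_sum_mset image_mset.compositionality o_def)
  qed
  show ?thesis
    by (rule exI[of _ p], rule exI[of _ "\<lambda>k. l k - ?c"]) (use cols shifted energy in simp)
qed

text \<open>In an orthonormal eigenbasis the pairing becomes the sum of \<open>\<mu> k\<close> times
  the form of \<open>U\<close> at \<open>p k\<close>. Each such form value has modulus at most 1
  because \<open>p k\<close> is a unit vector.\<close>

lemma energy_ge_pairing:
  fixes U :: "nat \<Rightarrow> nat \<Rightarrow> real"
  assumes U: "\<And>x. \<bar>\<Sum>i<card V. \<Sum>j<card V. U i j * x i * x j\<bar> \<le> (\<Sum>i<card V. (x i)\<^sup>2)"
  shows "(\<Sum>i<card V. \<Sum>j<card V. loop_shifted_entry V E S i j * U i j) \<le> energy V E S"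
proof -
  let ?n = "card V"
  obtain p \<mu>
    where cols: "\<forall>k<?n. \<forall>k'<?n. (\<Sum>i<?n. p k i * p k' i) = (if k = k' then 1 else 0)"
      and entries: "\<forall>i<?n. \<forall>j<?n.
        loop_shifted_entry V E S i j = (\<Sum>k<?n. \<mu> k * p k i * p k j)"
      and energy: "energy V E S = (\<Sum>k<?n. \<bar>\<mu> k\<bar>)"
    using energy_spectral[of V E S] by blast
  have "(\<Sum>i<?n. \<Sum>j<?n. loop_shifted_entry V E S i j * U i j) =
      (\<Sum>i<?n. \<Sum>j<?n. \<Sum>k<?n. \<mu> k * (U i j * p k i * p k j))"
    by (intro sum.cong refl) (simp add: entries sum_distrib_left mult_ac)
  also have "\<dots> = (\<Sum>i<?n. \<Sum>k<?n. \<Sum>j<?n. \<mu> k * (U i j * p k i * p k j))"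
    by (intro sum.cong refl sum.swap)
  also have "\<dots> = (\<Sum>k<?n. \<Sum>i<?n. \<Sum>j<?n. \<mu> k * (U i j * p k i * p k j))"
    by (rule sum.swap)
  also have "\<dots> = (\<Sum>k<?n. \<mu> k * (\<Sum>i<?n. \<Sum>j<?n. U i j * p k i * p k j))"
    by (simp add: sum_distrib_left)
  also have "\<dots> \<le> (\<Sum>k<?n. \<bar>\<mu> k\<bar>)"
  proof (rule sum_mono)
    fix k assume "k \<in> {..<?n}"
    hence "\<bar>\<Sum>i<?n. \<Sum>j<?n. U i j * p k i * p k j\<bar> \<le> 1"
      using U[of "p k"] cols by (simp add: power2_eq_square)
    hence "\<bar>\<mu> k\<bar> * \<bar>\<Sum>i<?n. \<Sum>j<?n. U i j * p k i * p k j\<bar> \<le> \<bar>\<mu> k\<bar>"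
      by (intro mult_left_le) auto
    thus "\<mu> k * (\<Sum>i<?n. \<Sum>j<?n. U i j * p k i * p k j) \<le> \<bar>\<mu> k\<bar>"
      by (simp flip: abs_mult)
  qed
  finally show ?thesis by (simp add: energy)
qed

lemma energy_square_le:
  "(energy V E S)\<^sup>2 \<le> card V * (\<Sum>i<card V. \<Sum>j<card V. (loop_shifted_entry V E S i j)\<^sup>2)"
proof -
  let ?n = "card V"
  obtain p \<mu>
    where cols: "\<forall>k<?n. \<forall>k'<?n. (\<Sum>i<?n. p k i * p k' i) = (if k = k' then 1 else 0)"
      and entries: "\<forall>i<?n. \<forall>j<?n.
        loop_shifted_entry V E S i j = (\<Sum>k<?n. \<mu> k * p k i * p k j)"
      and energy: "energy V E S = (\<Sum>k<?n. \<bar>\<mu> k\<bar>)"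
    using energy_spectral[of V E S] by blast
  have "(\<Sum>i<?n. \<Sum>j<?n. (loop_shifted_entry V E S i j)\<^sup>2) =
      (\<Sum>i<?n. \<Sum>j<?n. \<Sum>k<?n. \<Sum>k'<?n. \<mu> k * \<mu> k' * (p k i * p k' i) * (p k j * p k' j))"
    by (intro sum.cong refl) (simp add: entries power2_eq_square sum_product mult_ac)
  \<comment> \<open>The sums over \<open>k\<close> and \<open>k'\<close> are moved outwards, so that
    those over \<open>i\<close> and \<open>j\<close> factor into two copies of the inner product of
    \<open>p k\<close> and \<open>p k'\<close>.\<close>
  also have "\<dots> = (\<Sum>i<?n. \<Sum>k<?n. \<Sum>j<?n. \<Sum>k'<?n. \<mu> k * \<mu> k' * (p k i * p k' i) * (p k j * p k' j))"
    by (intro sum.cong refl sum.swap)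
  also have "\<dots> = (\<Sum>k<?n. \<Sum>i<?n. \<Sum>j<?n. \<Sum>k'<?n. \<mu> k * \<mu> k' * (p k i * p k' i) * (p k j * p k' j))"
    by (rule sum.swap)
  also have "\<dots> = (\<Sum>k<?n. \<Sum>i<?n. \<Sum>k'<?n. \<Sum>j<?n. \<mu> k * \<mu> k' * (p k i * p k' i) * (p k j * p k' j))"
    by (intro sum.cong refl sum.swap)
  also have "\<dots> = (\<Sum>k<?n. \<Sum>k'<?n. \<Sum>i<?n. \<Sum>j<?n. \<mu> k * \<mu> k' * (p k i * p k' i) * (p k j * p k' j))"
    by (intro sum.cong refl sum.swap)
  also have "\<dots> = (\<Sum>k<?n. \<Sum>k'<?n. \<mu> k * \<mu> k' * ((\<Sum>i<?n. p k i * p k' i) * (\<Sum>i<?n. p k i * p k' i)))"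
    unfolding sum_product by (simp add: sum_distrib_left mult.assoc)
  also have "\<dots> = (\<Sum>k<?n. \<Sum>k'<?n. if k' = k then (\<mu> k)\<^sup>2 else 0)"
    by (intro sum.cong refl) (auto simp: cols power2_eq_square)
  also have "\<dots> = (\<Sum>k<?n. \<bar>\<mu> k\<bar>\<^sup>2)" by simp
  finally show ?thesis
    using Cauchy_Schwarz_ineq_sum[of "\<lambda>_. 1" "\<lambda>k. \<bar>\<mu> k\<bar>" "{..<?n}"] by (simp add: energy)
qed

section \<open>The shifted matrices of the graph and its complement\<close>

lemma sum_loop_indicator:
  assumes "finite V" "S \<subseteq> V"
  shows "(\<Sum>i<card V. if from_nat_into V i \<in> S then 1 else 0) = real (card S)"
proof -
  have "(\<Sum>i<card V. if from_nat_into V i \<in> S then 1 else 0) = (\<Sum>v\<in>V. if v \<in> S then 1 else (0::real))"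
    by (rule sum.reindex_bij_betw[OF bij_betw_from_nat_into_finite[OF assms(1)]])
  thus ?thesis using assms by (simp add: sum.If_cases Int_absorb1)
qed

text \<open>Off the diagonal exactly one of the two entries is 1 and the other is 0. On the diagonal
  both equal \<open>\<delta>\<close>, because the complement keeps the loops.\<close>

lemma loop_shifted_entry_complement:
  fixes V S :: "'a set"
  assumes G: "simple_graph V E" and i: "i < card V" and j: "j < card V"
  defines "\<delta> \<equiv> (if from_nat_into V i \<in> S then 1 else 0) - real (card S) / real (card V)"
  shows "loop_shifted_entry V E S i j + loop_shifted_entry V (complement_edges V E) S i j
      = (if i = j then 2 * \<delta> else 1)"
    and "(loop_shifted_entry V E S i j)\<^sup>2 + (loop_shifted_entry V (complement_edges V E) S i j)\<^sup>2
      = (if i = j then 2 * \<delta>\<^sup>2 else 1)"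
proof -
  let ?v = "from_nat_into V"
  have fin: "finite V" and E: "E \<subseteq> {e. e \<subseteq> V \<and> card e = 2}"
    using G by (auto simp: simple_graph_def)
  have bij: "bij_betw ?v {..<card V} V" by (rule bij_betw_from_nat_into_finite[OF fin])
  have "?v i \<in> V" "?v j \<in> V" using bij i j by (auto simp: bij_betw_def)
  moreover have "?v i = ?v j \<longleftrightarrow> i = j"
    using bij i j by (auto simp: bij_betw_def dest: inj_onD)
  ultimately have "{?v i, ?v j} \<in> {e. e \<subseteq> V \<and> card e = 2} \<longleftrightarrow> i \<noteq> j"
    by (auto simp: card_insert_if)
  hence "{?v i, ?v j} \<in> complement_edges V E \<longleftrightarrow> i \<noteq> j \<and> {?v i, ?v j} \<notin> E"
    and "{?v i, ?v j} \<in> E \<Longrightarrow> i \<noteq> j"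
    using E by (auto simp: complement_edges_def)
  thus "loop_shifted_entry V E S i j + loop_shifted_entry V (complement_edges V E) S i j
      = (if i = j then 2 * \<delta> else 1)"
    and "(loop_shifted_entry V E S i j)\<^sup>2 + (loop_shifted_entry V (complement_edges V E) S i j)\<^sup>2
      = (if i = j then 2 * \<delta>\<^sup>2 else 1)"
    using i j by (auto simp: loop_shifted_entry_def self_loop_adjacency_matrix_def
        adjacency_matrix_def loop_matrix_def \<delta>_def)
qed

section \<open>The upper bound\<close>

lemma energy_complement_le:
  assumes G: "simple_graph V E" and S: "S \<subseteq> V" and n: "card V \<ge> 2"
  shows "energy V E S + energy V (complement_edges V E) S \<le> energy_upper (card V) (card S)"
proof -
  let ?E' = "complement_edges V E"
  let ?M = "loop_shifted_entry V E S" and ?M' = "loop_shifted_entry V ?E' S"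
  define n where "n = card V"
  define \<sigma> where "\<sigma> = real (card S)"
  define d where "d i = (if from_nat_into V i \<in> S then 1 else 0 :: real)" for i
  have fin: "finite V" using G by (simp add: simple_graph_def)
  have n2: "real n \<ge> 2" using n by (simp add: n_def)
  have \<sigma>: "0 \<le> \<sigma>" "\<sigma> \<le> n" using card_mono[OF fin S] by (auto simp: \<sigma>_def n_def)
  have sum_d: "(\<Sum>i<n. d i) = \<sigma>" unfolding d_def n_def \<sigma>_def by (rule sum_loop_indicator[OF fin S])
  have "(\<Sum>i<n. \<Sum>j<n. (?M i j)\<^sup>2) + (\<Sum>i<n. \<Sum>j<n. (?M' i j)\<^sup>2)
      = (\<Sum>i<n. \<Sum>j<n. if i = j then 2 * (d i - \<sigma> / n)\<^sup>2 else 1)"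
    unfolding sum.distrib[symmetric] using loop_shifted_entry_complement(2)[OF G, of _ _ S]
    by (intro sum.cong refl) (simp add: n_def d_def \<sigma>_def)
  also have "\<dots> = (\<Sum>i<n. \<Sum>j<n. 1 + (if j = i then 2 * (d i - \<sigma> / n)\<^sup>2 - 1 else 0))"
    by (intro sum.cong refl) auto
  \<comment> \<open>As \<open>d i\<close> is 0 or 1, \<open>(d i)^2 = d i\<close>, so the summand is
    affine in \<open>d i\<close> and only the sum of the \<open>d i\<close> matters.\<close>
  also have "\<dots> = (\<Sum>i<n. real n + (2 * (1 - 2 * \<sigma> / n) * d i + 2 * (\<sigma> / n)\<^sup>2 - 1))"
    by (intro sum.cong refl) (auto simp: sum.distrib d_def power2_eq_square field_simps)
  also have "\<dots> = n * n + 2 * (1 - 2 * \<sigma> / n) * (\<Sum>i<n. d i) + 2 * n * (\<sigma> / n)\<^sup>2 - n"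
    by (simp add: sum.distrib sum_subtractf flip: sum_distrib_left)
  also have "\<dots> = n * n - n + 2 * \<sigma> * (n - \<sigma>) / n"
    unfolding sum_d using n2 by (simp add: field_simps power2_eq_square)
  finally have frob: "(\<Sum>i<n. \<Sum>j<n. (?M i j)\<^sup>2) + (\<Sum>i<n. \<Sum>j<n. (?M' i j)\<^sup>2)
      = n * n - n + 2 * \<sigma> * (n - \<sigma>) / n" .
  have "(energy V E S + energy V ?E' S)\<^sup>2 \<le> 2 * ((energy V E S)\<^sup>2 + (energy V ?E' S)\<^sup>2)"
    using sum_squares_bound[of "energy V E S" "energy V ?E' S"] by (simp add: power2_sum)
  also have "\<dots> \<le> 2 * (n * ((\<Sum>i<n. \<Sum>j<n. (?M i j)\<^sup>2) + (\<Sum>i<n. \<Sum>j<n. (?M' i j)\<^sup>2)))"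
    using energy_square_le[of V E S] energy_square_le[of V ?E' S]
    by (simp add: n_def distrib_left)
  also have "\<dots> = 2 * (real n * (real n * (real n - 1))) + 4 * (\<sigma> * (n - \<sigma>))"
    unfolding frob using n2 by (simp add: field_simps)
  \<comment> \<open>The right side is the square of \<open>energy_upper\<close>. Because
    \<open>n - 1 \<ge> 1\<close>, each term on the left is at most a quarter of its
    counterpart.\<close>
  also have "\<dots> \<le> 8 * ((real n * (real n - 1)) * (real n * (real n - 1))) + 16 * ((real n - 1) * (\<sigma> * (n - \<sigma>)))"
  proof -
    have "real n * (real n * (real n - 1)) \<le> (real n * (real n - 1)) * (real n * (real n - 1))"
      using n2 mult_left_mono[of 1 "real n - 1" "n * (real n * (real n - 1))"]
      by (simp add: algebra_simps)
    moreover have "0 \<le> real n * (real n * (real n - 1))" using n2 by simp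
    moreover have "0 \<le> \<sigma> * (n - \<sigma>)" using \<sigma> by simp
    moreover have "1 * (\<sigma> * (n - \<sigma>)) \<le> (real n - 1) * (\<sigma> * (n - \<sigma>))"
      using n2 \<sigma> by (intro mult_right_mono) auto
    ultimately show ?thesis by linarith
  qed
  also have "\<dots> = (energy_upper (card V) (card S))\<^sup>2"
  proof -
    have "0 \<le> 2 * \<sigma> * (real n - 1) * (real n - \<sigma>) + ((real n)\<^sup>2 - real n)\<^sup>2"
      using n2 \<sigma> by simp
    thus ?thesis
      by (simp add: energy_upper_def power_mult_distrib flip: n_def \<sigma>_def)
        (simp add: algebra_simps power2_eq_square)
  qed
  finally show ?thesis
  proof (rule power2_le_imp_le)
    show "0 \<le> energy_upper (card V) (card S)"
      using n2 \<sigma> by (simp add: energy_upper_def flip: n_def \<sigma>_def)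
  qed
qed

section \<open>The lower bound\<close>

lemma energy_complement_ge_pairing:
  fixes U :: "nat \<Rightarrow> nat \<Rightarrow> real"
  assumes G: "simple_graph V E"
    and U: "\<And>x. \<bar>\<Sum>i<card V. \<Sum>j<card V. U i j * x i * x j\<bar> \<le> (\<Sum>i<card V. (x i)\<^sup>2)"
  shows "(\<Sum>i<card V. \<Sum>j<card V. U i j) + (\<Sum>i<card V.
      (2 * (if from_nat_into V i \<in> S then 1 else 0) - 2 * real (card S) / real (card V) - 1) * U i i)
    \<le> energy V E S + energy V (complement_edges V E) S"
proof -
  let ?n = "card V" and ?E' = "complement_edges V E"
  let ?M = "loop_shifted_entry V E S" and ?M' = "loop_shifted_entry V ?E' S"
  \<comment> \<open>\<open>?t\<close> is the diagonal of \<open>M + M'\<close> minus that of the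
    all-ones matrix, so the left side of the claim pairs \<open>U\<close> with
    \<open>M + M'\<close>.\<close>
  let ?t = "\<lambda>i. 2 * (if from_nat_into V i \<in> S then 1 else 0) - 2 * real (card S) / real (card V) - 1 :: real"
  have "(\<Sum>i<?n. \<Sum>j<?n. U i j) + (\<Sum>i<?n. ?t i * U i i)
      = (\<Sum>i<?n. \<Sum>j<?n. U i j + (if j = i then ?t i * U i i else 0))"
    by (simp add: sum.distrib)
  also have "\<dots> = (\<Sum>i<?n. \<Sum>j<?n. (?M i j + ?M' i j) * U i j)"
    by (intro sum.cong refl) (auto simp: loop_shifted_entry_complement(1)[OF G] algebra_simps)
  also have "\<dots> = (\<Sum>i<?n. \<Sum>j<?n. ?M i j * U i j) + (\<Sum>i<?n. \<Sum>j<?n. ?M' i j * U i j)"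
    by (simp add: distrib_right sum.distrib)
  also have "\<dots> \<le> energy V E S + energy V ?E' S"
    by (intro add_mono energy_ge_pairing U)
  finally show ?thesis .
qed

text \<open>
  \<open>U\<close> acts as \<open>g\<close> and \<open>- 1\<close> on the vectors supported on \<open>d = 1\<close> resp. \<open>d = 0\<close> and summing to
  zero, and as the matrix with rows \<open>(p, r)\<close> and \<open>(r, q)\<close> in the orthonormal basis of the two
  normalised indicator vectors.
\<close>

lemma block_form_bound:
  fixes d x :: "nat \<Rightarrow> real" and g p q r \<sigma> \<tau> :: real
  assumes d: "\<And>i. d i = 0 \<or> d i = 1"
    and \<sigma>: "\<sigma> = (\<Sum>i<n. d i)" "\<sigma> > 0" and \<tau>: "\<tau> = (\<Sum>i<n. 1 - d i)" "\<tau> > 0"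
    and g: "\<bar>g\<bar> \<le> 1"
    and pqr: "\<And>u w. \<bar>p * u\<^sup>2 + q * w\<^sup>2 + 2 * r * u * w\<bar> \<le> u\<^sup>2 + w\<^sup>2"
  defines "U \<equiv> \<lambda>i j. (if i = j then g * d i - (1 - d i) else 0)
    + (p - g) / \<sigma> * (d i * d j) + (q + 1) / \<tau> * ((1 - d i) * (1 - d j))
    + r / (sqrt \<sigma> * sqrt \<tau>) * (d i * (1 - d j) + (1 - d i) * d j)"
  shows "\<bar>\<Sum>i<n. \<Sum>j<n. U i j * x i * x j\<bar> \<le> (\<Sum>i<n. (x i)\<^sup>2)"
proof -
  define X where "X = (\<Sum>i<n. d i * x i)"
  define Y where "Y = (\<Sum>i<n. (1 - d i) * x i)"
  define a where "a = (\<Sum>i<n. d i * (x i)\<^sup>2)"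
  define b where "b = (\<Sum>i<n. (1 - d i) * (x i)\<^sup>2)"
  \<comment> \<open>\<open>u\<close> and \<open>w\<close> are the coordinates of \<open>x\<close>
    along the normalised indicator vectors. Thus \<open>a - u^2\<close> and \<open>b - w^2\<close>
    are the squared norms of the components summing to zero on the two blocks.\<close>
  define u where "u = X / sqrt \<sigma>"
  define w where "w = Y / sqrt \<tau>"
  have dd: "(d i)\<^sup>2 = d i" "(1 - d i)\<^sup>2 = 1 - d i" for i using d[of i] by auto
  have X2: "X\<^sup>2 \<le> \<sigma> * a"
    using Cauchy_Schwarz_ineq_sum[of d "\<lambda>i. d i * x i" "{..<n}"]
    by (simp add: X_def a_def \<sigma>(1) power_mult_distrib dd flip: mult.assoc power2_eq_square)
  have Y2: "Y\<^sup>2 \<le> \<tau> * b"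
    using Cauchy_Schwarz_ineq_sum[of "\<lambda>i. 1 - d i" "\<lambda>i. (1 - d i) * x i" "{..<n}"]
    by (simp only: Y_def b_def \<tau>(1) power_mult_distrib dd flip: mult.assoc power2_eq_square)
  have u: "u\<^sup>2 \<le> a" and w: "w\<^sup>2 \<le> b"
    using X2 Y2 \<sigma>(2) \<tau>(2) by (simp_all add: u_def w_def power_divide field_simps)
  define \<alpha> where "\<alpha> = (p - g) / \<sigma>"
  define \<beta> where "\<beta> = (q + 1) / \<tau>"
  define \<gamma> where "\<gamma> = r / (sqrt \<sigma> * sqrt \<tau>)"
  have U: "U i j = (if i = j then g * d i - (1 - d i) else 0) + \<alpha> * (d i * d j)
      + \<beta> * ((1 - d i) * (1 - d j)) + \<gamma> * (d i * (1 - d j) + (1 - d i) * d j)" for i j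
    by (simp add: U_def \<alpha>_def \<beta>_def \<gamma>_def)
  have "(\<Sum>i<n. \<Sum>j<n. U i j * x i * x j) = (\<Sum>i<n. \<Sum>j<n.
      (if j = i then g * (d i * (x i)\<^sup>2) - (1 - d i) * (x i)\<^sup>2 else 0)
      + \<alpha> * ((d i * x i) * (d j * x j))
      + \<beta> * (((1 - d i) * x i) * ((1 - d j) * x j))
      + \<gamma> * ((d i * x i) * ((1 - d j) * x j) + ((1 - d i) * x i) * (d j * x j)))"
    by (intro sum.cong refl) (auto simp: U algebra_simps power2_eq_square)
  also have "\<dots> = (g * a - b) + \<alpha> * (X * X) + \<beta> * (Y * Y)
      + \<gamma> * (X * Y + Y * X)"
    unfolding X_def Y_def a_def b_def sum_product
    by (simp only: sum.distrib sum_subtractf sum_distrib_left[symmetric]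
        sum.delta[OF finite_lessThan] lessThan_iff if_True cong: sum.cong) (simp add: sum_subtractf sum_distrib_left)
  also have "\<dots> = g * (a - u\<^sup>2) - (b - w\<^sup>2) + (p * u\<^sup>2 + q * w\<^sup>2 + 2 * r * u * w)"
  proof -
    have "u\<^sup>2 = X * X / \<sigma>" "w\<^sup>2 = Y * Y / \<tau>"
      "2 * r * u * w = \<gamma> * (X * Y + Y * X)"
      using \<sigma>(2) \<tau>(2)
      by (simp_all add: u_def w_def \<gamma>_def power_divide power2_eq_square)
    thus ?thesis
      by (simp add: \<alpha>_def \<beta>_def algebra_simps diff_divide_distrib add_divide_distrib)
  qed
  finally have form: "(\<Sum>i<n. \<Sum>j<n. U i j * x i * x j)
      = g * (a - u\<^sup>2) - (b - w\<^sup>2) + (p * u\<^sup>2 + q * w\<^sup>2 + 2 * r * u * w)" .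
  \<comment> \<open>The three parts of the form are bounded by \<open>a - u^2\<close>,
    \<open>b - w^2\<close> and \<open>u^2 + w^2\<close>, which add up to
    \<open>a + b\<close>.\<close>
  have "\<bar>g * (a - u\<^sup>2)\<bar> \<le> a - u\<^sup>2"
    using mult_right_mono[OF g, of "a - u\<^sup>2"] u by (simp add: abs_mult)
  moreover have "(\<Sum>i<n. (x i)\<^sup>2) = a + b"
    by (simp add: a_def b_def left_diff_distrib sum_subtractf)
  ultimately show ?thesis
    unfolding form using pqr[of u w] w by linarith
qed

text \<open>The pairing of \<open>U\<close> with \<open>M + M'\<close>, evaluated block by block.
  The vectors summing to zero have dimensions \<open>\<sigma> - 1\<close> and
  \<open>\<tau> - 1\<close>; there \<open>M + M'\<close> is \<open>1 - c\<close> resp.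
  \<open>- 1 - c\<close>, against \<open>g\<close> resp. \<open>- 1\<close>. On the normalised
  indicator vectors \<open>M + M'\<close> has diagonal \<open>\<sigma> + 1 - c\<close>,
  \<open>\<tau> - 1 - c\<close> and off-diagonal entry \<open>sqrt \<sigma> * sqrt \<tau>\<close>,
  against \<open>p\<close>, \<open>q\<close>, \<open>r\<close>.\<close>

lemma energy_complement_ge_block:
  fixes p q r g :: real
  assumes G: "simple_graph V E" and S: "S \<subseteq> V"
    and \<sigma>0: "0 < card S" and \<sigma>n: "card S < card V"
    and g: "\<bar>g\<bar> \<le> 1"
    and pqr: "\<And>u w. \<bar>p * u\<^sup>2 + q * w\<^sup>2 + 2 * r * u * w\<bar> \<le> u\<^sup>2 + w\<^sup>2"
  defines "\<sigma> \<equiv> real (card S)" and "\<tau> \<equiv> real (card V) - real (card S)"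
    and "c \<equiv> 2 * real (card S) / real (card V)"
  shows "g * (1 - c) * (\<sigma> - 1) + (1 + c) * (\<tau> - 1)
      + p * (\<sigma> + 1 - c) + q * (\<tau> - 1 - c) + 2 * r * (sqrt \<sigma> * sqrt \<tau>)
    \<le> energy V E S + energy V (complement_edges V E) S"
proof -
  define n where "n = card V"
  define d where "d i = (if from_nat_into V i \<in> S then 1 else 0 :: real)" for i
  define U where "U = (\<lambda>i j. (if i = j then g * d i - (1 - d i) else 0)
    + (p - g) / \<sigma> * (d i * d j) + (q + 1) / \<tau> * ((1 - d i) * (1 - d j))
    + r / (sqrt \<sigma> * sqrt \<tau>) * (d i * (1 - d j) + (1 - d i) * d j))"
  have fin: "finite V" using G by (simp add: simple_graph_def)
  have d: "d i = 0 \<or> d i = 1" for i by (simp add: d_def)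
  have sum_d: "(\<Sum>i<n. d i) = \<sigma>" unfolding d_def n_def \<sigma>_def by (rule sum_loop_indicator[OF fin S])
  hence sum_e: "(\<Sum>i<n. 1 - d i) = \<tau>" by (simp add: sum_subtractf \<tau>_def n_def \<sigma>_def)
  have pos: "\<sigma> > 0" "\<tau> > 0" using \<sigma>0 \<sigma>n by (simp_all add: \<sigma>_def \<tau>_def)
  have "(\<Sum>i<n. \<Sum>j<n. U i j) + (\<Sum>i<n. (2 * d i - c - 1) * U i i)
      \<le> energy V E S + energy V (complement_edges V E) S"
    unfolding n_def d_def c_def
  proof (rule energy_complement_ge_pairing[OF G])
    fix x :: "nat \<Rightarrow> real"
    show "\<bar>\<Sum>i<card V. \<Sum>j<card V. U i j * x i * x j\<bar> \<le> (\<Sum>i<card V. (x i)\<^sup>2)"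
      unfolding U_def n_def[symmetric]
      by (rule block_form_bound[OF d sum_d[symmetric] pos(1) sum_e[symmetric] pos(2) g pqr])
  qed
  moreover have "(\<Sum>i<n. \<Sum>j<n. U i j) = (g * \<sigma> - \<tau>) + (p - g) / \<sigma> * (\<sigma> * \<sigma>)
      + (q + 1) / \<tau> * (\<tau> * \<tau>) + r / (sqrt \<sigma> * sqrt \<tau>) * (\<sigma> * \<tau> + \<tau> * \<sigma>)"
  proof -
    have "(\<Sum>i<n. \<Sum>j<n. U i j) = (\<Sum>i<n. \<Sum>j<n. (if j = i then g * d i - (1 - d i) else 0)
        + (p - g) / \<sigma> * (d i * d j) + (q + 1) / \<tau> * ((1 - d i) * (1 - d j))
        + r / (sqrt \<sigma> * sqrt \<tau>) * (d i * (1 - d j) + (1 - d i) * d j))"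
      by (intro sum.cong refl) (auto simp: U_def)
    also have "\<dots> = (g * (\<Sum>i<n. d i) - (\<Sum>i<n. 1 - d i))
        + (p - g) / \<sigma> * ((\<Sum>i<n. d i) * (\<Sum>i<n. d i))
        + (q + 1) / \<tau> * ((\<Sum>i<n. 1 - d i) * (\<Sum>i<n. 1 - d i))
        + r / (sqrt \<sigma> * sqrt \<tau>) * ((\<Sum>i<n. d i) * (\<Sum>i<n. 1 - d i) + (\<Sum>i<n. 1 - d i) * (\<Sum>i<n. d i))"
      unfolding sum_product
      by (simp only: sum.distrib sum_distrib_left[symmetric]
          sum.delta[OF finite_lessThan] lessThan_iff if_True cong: sum.cong)
        (simp add: sum_subtractf sum_distrib_left)
    finally show ?thesis unfolding sum_d sum_e .
  qed
  moreover have "(\<Sum>i<n. (2 * d i - c - 1) * U i i)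
      = (1 - c) * (g + (p - g) / \<sigma>) * \<sigma> + (- c - 1) * ((q + 1) / \<tau> - 1) * \<tau>"
  proof -
    have "(2 * d i - c - 1) * U i i
        = (1 - c) * (g + (p - g) / \<sigma>) * d i + (- c - 1) * ((q + 1) / \<tau> - 1) * (1 - d i)" for i
      using d[of i] by (elim disjE) (simp_all add: U_def)
    thus ?thesis
      by (simp only: sum.distrib sum_distrib_left[symmetric] sum_d sum_e)
  qed
  moreover have "r / (sqrt \<sigma> * sqrt \<tau>) * (\<sigma> * \<tau> + \<tau> * \<sigma>) = 2 * r * (sqrt \<sigma> * sqrt \<tau>)"
  proof -
    have "\<sigma> * \<tau> = (sqrt \<sigma> * sqrt \<tau>) * (sqrt \<sigma> * sqrt \<tau>)" using pos by (simp add: real_sqrt_mult[symmetric])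
    thus ?thesis using pos by (simp add: field_simps)
  qed
  moreover have "(p - g) / \<sigma> * (\<sigma> * \<sigma>) = (p - g) * \<sigma>" "(q + 1) / \<tau> * (\<tau> * \<tau>) = (q + 1) * \<tau>"
    "(1 - c) * (g + (p - g) / \<sigma>) * \<sigma> = (1 - c) * (g * \<sigma> + (p - g))"
    "(- c - 1) * ((q + 1) / \<tau> - 1) * \<tau> = (- c - 1) * ((q + 1) - \<tau>)"
    using pos by (simp_all add: field_simps)
  ultimately show ?thesis by (simp add: algebra_simps)
qed

text \<open>
  Without loops, or with all of them, one of the two blocks is empty; the test matrix is
  then \<open>2J/n - I\<close>.
\<close>

lemma energy_complement_ge_uniform:
  assumes G: "simple_graph V E" and n: "card V \<ge> 2" and S: "S = {} \<or> S = V"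
  shows "2 * real (card V) - 2 \<le> energy V E S + energy V (complement_edges V E) S"
proof -
  define n where "n = card V"
  define U where "U = (\<lambda>i j :: nat. 2 / real n - (if j = i then 1 else 0))"
  have n2: "n \<ge> 2" using n by (simp add: n_def)
  have from_V: "from_nat_into V i \<in> V" for i using n by (intro from_nat_into) auto
  have "(\<Sum>i<n. \<Sum>j<n. U i j) + (\<Sum>i<n.
      (2 * (if from_nat_into V i \<in> S then 1 else 0) - 2 * real (card S) / real (card V) - 1) * U i i)
    \<le> energy V E S + energy V (complement_edges V E) S"
    unfolding n_def
  proof (rule energy_complement_ge_pairing[OF G])
    fix x :: "nat \<Rightarrow> real"
    define X where "X = (\<Sum>i<n. x i)"
    have "(\<Sum>i<n. \<Sum>j<n. U i j * x i * x j)
        = (\<Sum>i<n. \<Sum>j<n. 2 / n * (x i * x j) - (if j = i then (x i)\<^sup>2 else 0))"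
      by (intro sum.cong refl) (auto simp: U_def algebra_simps power2_eq_square)
    also have "\<dots> = 2 / n * (X * X) - (\<Sum>i<n. (x i)\<^sup>2)"
      unfolding X_def sum_product by (simp add: sum_subtractf sum_distrib_left)
    finally have form: "(\<Sum>i<n. \<Sum>j<n. U i j * x i * x j)
      = 2 * (X\<^sup>2 / n) - (\<Sum>i<n. (x i)\<^sup>2)" by (simp add: power2_eq_square)
    have "X\<^sup>2 \<le> n * (\<Sum>i<n. (x i)\<^sup>2)"
      using Cauchy_Schwarz_ineq_sum[of "\<lambda>_. 1" x "{..<n}"] by (simp add: X_def)
    hence "X\<^sup>2 / n \<le> (\<Sum>i<n. (x i)\<^sup>2)" using n2 by (simp add: field_simps)
    moreover have "0 \<le> X\<^sup>2 / n" by simp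
    ultimately show "\<bar>\<Sum>i<card V. \<Sum>j<card V. U i j * x i * x j\<bar> \<le> (\<Sum>i<card V. (x i)\<^sup>2)"
      unfolding n_def[symmetric] form by linarith
  qed
  moreover have "(\<Sum>i<n. \<Sum>j<n. U i j) = n"
    using n2 by (simp add: U_def sum_subtractf)
  \<comment> \<open>The bracket is \<open>- 1\<close> in both cases: \<open>0 - 0 - 1\<close>
    without loops and \<open>2 - 2 - 1\<close> with all of them. So \<open>M + M'\<close> is
    \<open>J - I\<close> either way.\<close>
  moreover have "(\<Sum>i<n. (2 * (if from_nat_into V i \<in> S then 1 else 0)
      - 2 * real (card S) / real (card V) - 1) * U i i) = (\<Sum>i<n. 1 - 2 / real n)"
    using S from_V n2 by (intro sum.cong refl) (auto simp: U_def n_def)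
  moreover have "(\<Sum>i<n. 1 - 2 / real n) = n - 2"
    using n2 by (simp add: field_simps of_nat_diff)
  ultimately show ?thesis using n2 by (simp add: n_def of_nat_diff)
qed

lemma energy_complement_ge:
  assumes G: "simple_graph V E" and S: "S \<subseteq> V" and n: "card V \<ge> 2"
  shows "energy_lower (card V) (card S) \<le> energy V E S + energy V (complement_edges V E) S"
proof -
  define n where "n = real (card V)"
  define \<sigma> where "\<sigma> = real (card S)"
  let ?E = "energy V E S + energy V (complement_edges V E) S"
  have fin: "finite V" using G by (simp add: simple_graph_def)
  have n2: "n \<ge> 2" using n by (simp add: n_def)
  consider "S = {}" | "S = V" | "0 < card S" "card S < card V"
    using S fin by (metis card_gt_0_iff finite_subset psubsetI psubset_card_mono)
  then show ?thesis
  proof cases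
    case 1
    hence "energy_lower (card V) (card S) = 2 * n - 2"
      using n2 by (simp add: energy_lower_def flip: n_def) (simp add: field_simps)
    thus ?thesis using energy_complement_ge_uniform[OF G n] 1 by (simp add: n_def)
  next
    case 2
    have "(n - 2)\<^sup>2 + 8 * n = (n + 2)\<^sup>2" by (simp add: power2_eq_square algebra_simps)
    hence "energy_lower (card V) (card S) = 2 * n - 2"
      using n2 by (simp add: energy_lower_def 2 flip: n_def) (simp add: field_simps)
    thus ?thesis using energy_complement_ge_uniform[OF G n] 2 by (simp add: n_def)
  next
    case 3
    define \<tau> where "\<tau> = n - \<sigma>"
    define c where "c = 2 * \<sigma> / n"
    \<comment> \<open>The two-by-two block has trace \<open>n - 2 * c\<close>; \<open>a\<close> is
      half the difference of its diagonal entries and its eigenvalues are \<open>n / 2 - c\<close>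
      plus or minus \<open>h\<close>. \<open>R\<close> is the contribution of the vectors summing to
      zero, with \<open>g\<close> the sign of \<open>1 - c\<close>.\<close>
    define h where "h = sqrt ((n - 2)\<^sup>2 + 8 * \<sigma>) / 2"
    define a where "a = \<sigma> + 1 - n / 2"
    define g where "g = (if c \<le> 1 then 1 else - 1 :: real)"
    define R where "R = \<bar>1 - c\<bar> * (\<sigma> - 1) + (1 + c) * (\<tau> - 1)"
    have pos: "\<sigma> > 0" "\<tau> > 0" using 3 by (simp_all add: \<sigma>_def \<tau>_def n_def)
    have g: "\<bar>g\<bar> \<le> 1" and gc: "g * (1 - c) = \<bar>1 - c\<bar>" by (auto simp: g_def)
    have "h\<^sup>2 = ((n - 2)\<^sup>2 + 8 * \<sigma>) / 4"
      using pos by (simp add: h_def power_divide)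
    hence h2: "h\<^sup>2 = a\<^sup>2 + \<sigma> * \<tau>"
      by (simp add: a_def \<tau>_def power2_eq_square field_simps)
    have h: "h > 0" using pos by (simp add: h_def add_nonneg_pos)
    note block = energy_complement_ge_block[OF G S 3 g, folded \<sigma>_def n_def, folded \<tau>_def c_def]
    have block': "R + p * (\<sigma> + 1 - c) + q * (\<tau> - 1 - c) + 2 * r * (sqrt \<sigma> * sqrt \<tau>) \<le> ?E"
      if "\<And>u w. \<bar>p * u\<^sup>2 + q * w\<^sup>2 + 2 * r * u * w\<bar> \<le> u\<^sup>2 + w\<^sup>2" for p q r
      using block[OF that] unfolding R_def gc by simp
    \<comment> \<open>Testing the two-by-two block against the identity and its negative yields plus
      and minus its trace.\<close>
    have "R + (n - 2 * c) \<le> ?E"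
      using block'[of 1 1 0] by (simp add: \<tau>_def)
    moreover have "R - (n - 2 * c) \<le> ?E"
      using block'[of "-1" "-1" 0] by (simp add: \<tau>_def abs_minus_commute)
    \<comment> \<open>The \<open>2 \<times> 2\<close> block minus half its trace has rows \<open>(a, r)\<close>, \<open>(r, - a)\<close> and square \<open>h\<^sup>2\<close>,
      where \<open>r\<^sup>2 = \<sigma>\<tau>\<close>, so dividing by \<open>h\<close> gives a reflection.\<close>
    moreover have "R + 2 * h \<le> ?E"
    proof -
      define r where "r = sqrt \<sigma> * sqrt \<tau>"
      have cauchy_schwarz: "(s * x + t * y)\<^sup>2 \<le> (s\<^sup>2 + t\<^sup>2) * (x\<^sup>2 + y\<^sup>2)" for s t x y :: real
        using zero_le_power2[of "s * y - t * x"] by (simp add: power2_eq_square algebra_simps)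
      have r2: "r\<^sup>2 = \<sigma> * \<tau>" using pos by (simp add: r_def power_mult_distrib)
      have "R + a / h * (\<sigma> + 1 - c) + - a / h * (\<tau> - 1 - c) + 2 * (r / h) * r \<le> ?E"
      unfolding r_def
      proof (rule block', fold r_def)
        fix u w :: real
        have "(a * (u\<^sup>2 - w\<^sup>2) + r * (2 * u * w))\<^sup>2
            \<le> (a\<^sup>2 + r\<^sup>2) * ((u\<^sup>2 - w\<^sup>2)\<^sup>2 + (2 * u * w)\<^sup>2)"
          by (rule cauchy_schwarz)
        also have "\<dots> = (h * (u\<^sup>2 + w\<^sup>2))\<^sup>2"
          unfolding power_mult_distrib[of h] h2 r2 by (simp add: power2_eq_square algebra_simps)
        finally have "\<bar>a * (u\<^sup>2 - w\<^sup>2) + r * (2 * u * w)\<bar> \<le> \<bar>h * (u\<^sup>2 + w\<^sup>2)\<bar>"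
          by (simp only: abs_le_square_iff)
        also have "\<dots> = h * (u\<^sup>2 + w\<^sup>2)" using h by simp
        finally have "\<bar>a * (u\<^sup>2 - w\<^sup>2) + r * (2 * u * w)\<bar> \<le> h * (u\<^sup>2 + w\<^sup>2)" .
        moreover have "a / h * u\<^sup>2 + - a / h * w\<^sup>2 + 2 * (r / h) * u * w
            = (a * (u\<^sup>2 - w\<^sup>2) + r * (2 * u * w)) / h"
          using h by (simp add: field_simps)
        ultimately show "\<bar>a / h * u\<^sup>2 + - a / h * w\<^sup>2 + 2 * (r / h) * u * w\<bar> \<le> u\<^sup>2 + w\<^sup>2"
          using h by (simp only: abs_divide abs_of_pos pos_divide_le_eq mult.commute)
      qed
      moreover have "a / h * (\<sigma> + 1 - c) + - a / h * (\<tau> - 1 - c) + 2 * (r / h) * r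
          = (a * (\<sigma> + 2 - \<tau>) + 2 * r\<^sup>2) / h"
        using h by (simp add: field_simps power2_eq_square)
      moreover have "a * (\<sigma> + 2 - \<tau>) + 2 * r\<^sup>2 = 2 * h\<^sup>2"
        unfolding h2 r2 by (simp add: a_def \<tau>_def power2_eq_square algebra_simps)
      moreover have "2 * h\<^sup>2 / h = 2 * h" using h by (simp add: power2_eq_square)
      ultimately show ?thesis by simp
    qed
    ultimately have test: "R + max \<bar>n - 2 * c\<bar> (2 * h) \<le> ?E"
      by (simp add: max_def abs_if)
    \<comment> \<open>With \<open>t\<close> the trace and \<open>w\<close> the eigenvalue gap of the
      two-by-two block, the left side is its trace norm, so the three tests together
      suffice.\<close>
    have max_abs: "1 / 2 * \<bar>t + w\<bar> + 1 / 2 * \<bar>t - w\<bar> \<le> max \<bar>t\<bar> w" if "w > 0" for t w :: real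
      using that by (simp add: abs_if max_def field_simps)
    have "energy_lower (card V) (card S)
        = R + (1 / 2 * \<bar>(n - 2 * c) + 2 * h\<bar> + 1 / 2 * \<bar>(n - 2 * c) - 2 * h\<bar>)"
      unfolding energy_lower_def n_def[symmetric] \<sigma>_def[symmetric]
      by (simp add: R_def c_def \<tau>_def h_def algebra_simps)
    also have "\<dots> \<le> R + max \<bar>n - 2 * c\<bar> (2 * h)"
      using max_abs[of "2 * h"] h by simp
    also note test
    finally show ?thesis .
  qed
qed

theorem theorem5p3:
  fixes V :: "'a set" and E :: "'a set set" and S :: "'a set"
    and n m \<sigma> :: nat
  assumes "simple_graph V E"
    and "card V = n" and "n \<ge> 2"
    and "card E = m" and "m \<ge> 1"
    and "S \<subseteq> V" and "card S = \<sigma>" and "0 \<le> \<sigma>" and "\<sigma> \<le> n"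
  shows "energy_lower n \<sigma> \<le> energy V E S + energy V (complement_edges V E) S
    \<and> energy V E S + energy V (complement_edges V E) S \<le> energy_upper n \<sigma>"
  using energy_complement_ge[of V E S] energy_complement_le[of V E S] assms by simp

end
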